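(* Let $n\in\omega$ and for $k<n$ let $A_k\subseteq{}^\omega2$ be $\Sigma^1_1$ with $E_0\le_{\Delta^1_1}E_0\upharpoonright A_k$, and suppose $[A_k]_{E_0}\subseteq[A_{k+1}]_{E_0}$ for all $k<n-1$. Then there exist $E_0$-trees $p_k$ ($k<n$) with $[p_k]\subseteq A_k$ such that for all $a,b<n$, $|s^{p_a}|=|s^{p_b}|$ and $v_m^{i,p_a}=v_m^{i,p_b}$ for all $m\in\omega$ and $i\in2$.
   Context: $E_0$ on ${}^\omega2$: $x\,E_0\,y$ iff $(\exists n)(\forall k>n)(x(k)=y(k))$. $[A]_{E_0}$ is the $E_0$-saturation $\{y:(\exists x\in A)(x\,E_0\,y)\}$. $E\le_{\Delta^1_1}F$ means there is a $\Delta^1_1$ function $\Phi$ with $a\,E\,b\iff\Phi(a)\,F\,\Phi(b)$. An $E_0$-tree is a tree $p\subseteq{}^{<\omega}2$ for which there are strings $s^p, v_m^{i,p}\in{}^{<\omega}2$ ($m\in\omega$, $i\in2$) with $\langle i\rangle\subseteq v_m^{i,p}$ and $|v_m^{0,p}|=|v_m^{1,p}|$, such that $p$ is the $\subseteq$-downward closure of $\{\varphi(\sigma):\sigma\in{}^{<\omega}2\}$, where $\varphi(\emptyset)=s^p$ and $\varphi(\sigma)=s^{p\frown}v_0^{\sigma(0),p\frown}\cdots{}^\frown v_{|\sigma|-1}^{\sigma(|\sigma|-1),p}$. $[p]$ denotes the set of infinite branches of $p$. *)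

theory Defs
  imports "HOL-Analysis.Analysis" "HOL-Library.Sublist"
begin

text \<open>
  Cantor space is the type \<open>nat \<Rightarrow> bool\<close> with its product topology (\<open>bool\<close> is discrete, and
  \<open>False\<close>, \<open>True\<close> stand for the digits 0, 1). Finite binary strings are of type \<open>bool list\<close>.

  The pointclasses are the boldface ones, so no parameter is mentioned; the lightface classes are
  contained in them. The definitions are intended for Polish spaces.
\<close>

definition Sigma11 :: "'a::topological_space set \<Rightarrow> bool" where
  "Sigma11 A \<longleftrightarrow> (\<exists>C :: ('a \<times> (nat \<Rightarrow> nat)) set. closed C \<and> A = fst ` C)"

definition Delta11 :: "'a::topological_space set \<Rightarrow> bool" where
  "Delta11 A \<longleftrightarrow> Sigma11 A \<and> Sigma11 (- A)"

definition Delta11_function :: "('a::topological_space \<Rightarrow> 'b::topological_space) \<Rightarrow> bool" where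
  "Delta11_function \<Phi> \<longleftrightarrow> Delta11 {(x, y). y = \<Phi> x}"

text \<open>
  \<open>E\<close> is an equivalence relation on the whole type, whereas \<open>F\<close> may live on a subset \<open>Y\<close>. No
  separate clause puts the values of \<open>\<Phi>\<close> in \<open>Y\<close>: reflexivity of \<open>E\<close> and \<open>F \<subseteq> Y \<times> Y\<close> imply it.
\<close>

definition Delta11_reducible ::
    "'a::topological_space rel \<Rightarrow> 'b::topological_space rel \<Rightarrow> bool" (infix "\<le>\<^sub>\<Delta>" 50) where
  "E \<le>\<^sub>\<Delta> F \<longleftrightarrow> (\<exists>\<Phi>. Delta11_function \<Phi> \<and> (\<forall>a b. (a, b) \<in> E \<longleftrightarrow> (\<Phi> a, \<Phi> b) \<in> F))"

definition E0 :: "(nat \<Rightarrow> bool) rel" where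
  "E0 = {(x, y). \<exists>n. \<forall>k>n. x k = y k}"

lemma E0_reducible_to_restriction_iff:
  "E0 \<le>\<^sub>\<Delta> Restr E0 A \<longleftrightarrow>
    (\<exists>\<Phi>. Delta11_function \<Phi> \<and> range \<Phi> \<subseteq> A \<and> (\<forall>a b. (a, b) \<in> E0 \<longleftrightarrow> (\<Phi> a, \<Phi> b) \<in> E0))"
proof -
  have "(a, a) \<in> E0" for a
    by (simp add: E0_def)
  then show ?thesis
    unfolding Delta11_reducible_def by (intro ex_cong1) blast
qed

text \<open>The saturation of \<open>A\<close> under \<open>E0\<close> is the relational image \<open>E0 `` A\<close>.\<close>

definition E0_tree_node :: "bool list \<Rightarrow> (nat \<Rightarrow> bool \<Rightarrow> bool list) \<Rightarrow> bool list \<Rightarrow> bool list" where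
  "E0_tree_node s v \<sigma> = s @ concat (map (\<lambda>m. v m (\<sigma> ! m)) [0..<length \<sigma>])"

text \<open>
  \<open>p\<close> is an \<open>E0\<close>-tree whose associated strings are \<open>s\<close> and \<open>v m i\<close>. These strings are determined
  by \<open>p\<close>, because the strings \<open>E0_tree_node s v \<sigma>\<close> are exactly the splitting nodes of \<open>p\<close>.
\<close>

definition is_E0_tree :: "bool list set \<Rightarrow> bool list \<Rightarrow> (nat \<Rightarrow> bool \<Rightarrow> bool list) \<Rightarrow> bool" where
  "is_E0_tree p s v \<longleftrightarrow>
    (\<forall>m i. prefix [i] (v m i)) \<and>
    (\<forall>m. length (v m False) = length (v m True)) \<and>
    p = {t. \<exists>\<sigma>. prefix t (E0_tree_node s v \<sigma>)}"

definition branches :: "bool list set \<Rightarrow> (nat \<Rightarrow> bool) set" where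
  "branches p = {x. \<forall>n. map x [0..<n] \<in> p}"

end

theory Submission
  imports Defs
begin

text \<open>
  Everything takes place inside \<open>A 0\<close>. Let \<open>\<Phi>\<close> reduce \<open>E0\<close> to its restriction to \<open>A 0\<close>. Each
  \<open>\<Phi> x\<close> has an \<open>E0\<close>-equivalent point in every \<open>A k\<close>, obtained by overwriting an initial segment
  with some string \<open>\<tau> k\<close> of a length not depending on \<open>k\<close>. Preimages of analytic sets under
  \<open>\<Phi>\<close> have the Baire property, so on a comeager set \<open>G\<close> the function \<open>\<Phi>\<close> is continuous, and in
  some basic open set the same strings \<open>\<tau> k\<close> work for all points of \<open>G\<close>. A single \<open>E0\<close>-tree in the
  image of \<open>G\<close> therefore suffices: the trees \<open>p k\<close> differ only in their stems.

  The tree is built by fusion. Suppose that changing the first digits of \<open>x\<close> only changes the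
  first digits of \<open>\<Phi> x\<close>, in a prescribed way. Two \<open>E0\<close>-inequivalent generic points have different
  images, so by continuity some two strings of the same length force different digits of \<open>\<Phi>\<close>. As
  \<open>\<Phi>\<close> preserves \<open>E0\<close>, the images obtained from the two strings agree from some digit on, and
  by the Baire category theorem this digit is constant after a further extension. This
  yields the next level of the tree.
\<close>

subsection \<open>Cylinders and comeager sets\<close>

definition cyl :: "'a list \<Rightarrow> (nat \<Rightarrow> 'a) set" where
  "cyl u = {x. \<forall>i<length u. x i = u ! i}"

text \<open>Overwriting instead of concatenating leaves all later positions in place, so the result
  stays in the \<open>E0\<close>-class of \<open>x\<close>.\<close>

definition graft :: "'a list \<Rightarrow> (nat \<Rightarrow> 'a) \<Rightarrow> nat \<Rightarrow> 'a" where
  "graft u x = (\<lambda>i. if i < length u then u ! i else x i)"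

lemma cyl_iff: "x \<in> cyl u \<longleftrightarrow> map x [0..<length u] = u"
proof
  assume "x \<in> cyl u"
  then show "map x [0..<length u] = u"
    by (intro nth_equalityI) (simp_all add: cyl_def)
next
  assume u: "map x [0..<length u] = u"
  have "x i = u ! i" if "i < length u" for i
    using arg_cong[OF u, of "\<lambda>l. l ! i"] that by simp
  then show "x \<in> cyl u"
    by (simp add: cyl_def)
qed

lemma mem_cyl_initial [simp]: "x \<in> cyl (map x [0..<n])"
  by (simp add: cyl_def)

lemma cyl_append: "cyl (u @ w) \<subseteq> cyl u"
  by (auto simp: cyl_def nth_append)

lemma cyl_prefix: "prefix u v \<Longrightarrow> cyl v \<subseteq> cyl u"
  using cyl_append by (auto elim!: prefixE)

lemma initial_extends:
  assumes "x \<in> cyl u" and "length u \<le> n"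
  shows "map x [0..<n] = u @ drop (length u) (map x [0..<n])"
  using assms by (intro nth_equalityI) (auto simp: cyl_def nth_append)

lemma cyl_Int_prefix:
  assumes "x \<in> cyl u" "x \<in> cyl v" "length u \<le> length v"
  shows "prefix u v"
proof (rule prefixI)
  have *: "map x [0..<length v] = v"
    using assms(2) by (simp add: cyl_iff)
  show "v = u @ drop (length u) v"
    using initial_extends[OF assms(1,3)] unfolding * .
qed

lemma cyl_initial_mono: "m \<le> n \<Longrightarrow> cyl (map x [0..<n]) \<subseteq> cyl (map x [0..<m])"
  by (auto simp: cyl_def)

lemma graft_in_cyl [simp]: "graft u x \<in> cyl u"
  by (simp add: graft_def cyl_def)

lemma graft_id: "x \<in> cyl u \<Longrightarrow> graft u x = x"
  by (simp add: graft_def cyl_def fun_eq_iff)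

lemma graft_graft: "length v \<le> length u \<Longrightarrow> graft u (graft v x) = graft u x"
  by (simp add: graft_def fun_eq_iff)

lemma graft_graft_append:
  "length u = length v \<Longrightarrow> graft u (graft (v @ w) x) = graft (u @ w) x"
  by (simp add: graft_def fun_eq_iff nth_append)

lemma graft_E0: "(graft u x, x) \<in> E0"
  unfolding E0_def graft_def by (intro CollectI case_prodI exI[of _ "length u"]) simp

lemma graft_append_cyl:
  assumes "x \<in> cyl (v @ w)" and "length u = length v"
  shows "graft u x \<in> cyl (u @ w)"
  using assms by (simp add: graft_def cyl_def nth_append)

lemma E0_sym: "(x, y) \<in> E0 \<Longrightarrow> (y, x) \<in> E0"
  unfolding E0_def by (simp add: eq_commute)

lemma E0_trans:
  assumes "(x, y) \<in> E0" and "(y, z) \<in> E0"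
  shows "(x, z) \<in> E0"
proof -
  obtain m n where "\<forall>k>m. x k = y k" "\<forall>k>n. y k = z k"
    using assms by (auto simp: E0_def)
  then show ?thesis
    unfolding E0_def by (intro CollectI case_prodI exI[of _ "max m n"]) simp
qed

lemma strict_prefix_chain_limit:
  assumes "\<And>n. strict_prefix (f n) (f (Suc n))"
  shows "\<exists>x. \<forall>n. x \<in> cyl (f n)"
proof -
  have mono: "prefix (f m) (f n)" if "m \<le> n" for m n
    using that
  proof (induction n rule: dec_induct)
    case (step n)
    then show ?case
      using assms[of n] by (meson prefix_order.trans strict_prefix_def)
  qed simp
  have len: "n \<le> length (f n)" for n
  proof (induction n)
    case (Suc n)
    then show ?case
      using prefix_length_less[OF assms[of n]] by simp
  qed simp
  \<comment> \<open>Digit \<open>i\<close> is read from \<open>f (Suc i)\<close>, which is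
    guaranteed to have a position \<open>i\<close>.\<close>
  have "(\<lambda>i. f (Suc i) ! i) \<in> cyl (f n)" for n
    unfolding cyl_def
  proof (intro CollectI allI impI)
    fix i assume i: "i < length (f n)"
    have "i < length (f (Suc i))"
      using len[of "Suc i"] by simp
    with i show "f (Suc i) ! i = f n ! i"
      using mono[of n "Suc i"] mono[of "Suc i" n]
      by (cases "n \<le> Suc i") (auto elim!: prefixE simp: nth_append)
  qed
  then show ?thesis
    by blast
qed

text \<open>The sets \<open>D n\<close> need not be open, only to contain dense open sets.\<close>

definition comeager :: "(nat \<Rightarrow> bool) set \<Rightarrow> bool" where
  "comeager S \<longleftrightarrow> (\<exists>D :: nat \<Rightarrow> (nat \<Rightarrow> bool) set.
     (\<forall>n u. \<exists>w. cyl (u @ w) \<subseteq> D n) \<and> (\<Inter>n. D n) \<subseteq> S)"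

lemma comeager_mono: "comeager S \<Longrightarrow> S \<subseteq> T \<Longrightarrow> comeager T"
  unfolding comeager_def by (meson subset_trans)

lemma comeager_dense: "(\<And>u. \<exists>w. cyl (u @ w) \<subseteq> S) \<Longrightarrow> comeager S"
  unfolding comeager_def by (intro exI[of _ "\<lambda>_. S"]) auto

lemma comeager_UNIV: "comeager UNIV"
  by (rule comeager_dense) simp

lemma comeager_INT:
  fixes S :: "'i::countable \<Rightarrow> (nat \<Rightarrow> bool) set"
  assumes "\<And>i. comeager (S i)"
  shows "comeager (\<Inter>i. S i)"
proof -
  obtain D :: "'i \<Rightarrow> nat \<Rightarrow> (nat \<Rightarrow> bool) set"
    where D: "\<And>i n u. \<exists>w. cyl (u @ w) \<subseteq> D i n" "\<And>i. (\<Inter>n. D i n) \<subseteq> S i"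
    using assms unfolding comeager_def by metis
  define D' where "D' k = D (from_nat (fst (prod_decode k))) (snd (prod_decode k))" for k
  have D': "(\<Inter>k. D' k) \<subseteq> D i n" for i n
    using INT_lower[of "prod_encode (to_nat i, n)" UNIV D'] by (simp add: D'_def)
  have "(\<Inter>k. D' k) \<subseteq> (\<Inter>i. S i)"
  proof (rule INT_greatest)
    fix i
    have "(\<Inter>k. D' k) \<subseteq> (\<Inter>n. D i n)"
      using D' by (rule INT_greatest)
    then show "(\<Inter>k. D' k) \<subseteq> S i"
      using D(2) by (rule subset_trans)
  qed
  then show ?thesis
    unfolding comeager_def using D(1) by (intro exI[of _ D']) (auto simp: D'_def)
qed

lemma comeager_Int: "comeager S \<Longrightarrow> comeager T \<Longrightarrow> comeager (S \<inter> T)"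
  by (rule comeager_mono[OF comeager_INT[of "\<lambda>b. if b then S else T"]])
    (auto split: if_splits)

text \<open>The Baire category theorem: extending \<open>u\<close> into the sets \<open>D n\<close>
  one after another gives a chain of strings whose limit lies in all of them.\<close>

lemma comeager_meets_cyl:
  assumes "comeager S"
  shows "\<exists>x\<in>S. x \<in> cyl u"
proof -
  obtain D :: "nat \<Rightarrow> (nat \<Rightarrow> bool) set"
    where D: "\<And>n u. \<exists>w. cyl (u @ w) \<subseteq> D n" "(\<Inter>n. D n) \<subseteq> S"
    using assms unfolding comeager_def by metis
  have "\<exists>f. \<forall>n. prefix u (f n) \<and> strict_prefix (f n) (f (Suc n)) \<and> cyl (f (Suc n)) \<subseteq> D n"
  proof -
    have "\<exists>f. \<forall>n. prefix u (f n) \<and> (strict_prefix (f n) (f (Suc n)) \<and> cyl (f (Suc n)) \<subseteq> D n)"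
    proof (rule dependent_nat_choice)
      fix v n assume v: "prefix u v"
      \<comment> \<open>The extra digit makes the extension proper even if density supplies the
        empty string.\<close>
      obtain w where w: "cyl ((v @ [True]) @ w) \<subseteq> D n"
        using D(1) by blast
      show "\<exists>v'. prefix u v' \<and> strict_prefix v v' \<and> cyl v' \<subseteq> D n"
        using v w by (intro exI[of _ "(v @ [True]) @ w"]) (auto simp: strict_prefix_def)
    qed auto
    then show ?thesis by blast
  qed
  then obtain f where f: "\<And>n. prefix u (f n)" "\<And>n. strict_prefix (f n) (f (Suc n))"
    "\<And>n. cyl (f (Suc n)) \<subseteq> D n"
    by blast
  obtain x where x: "\<And>n. x \<in> cyl (f n)"
    using strict_prefix_chain_limit[of f] f(2) by blast
  then have "x \<in> S"
    using f(3) D(2) by blast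
  moreover have "x \<in> cyl u"
    using x[of 0] cyl_prefix[OF f(1)[of 0]] by blast
  ultimately show ?thesis by blast
qed

text \<open>There are only countably many strings, so the requirements from all cylinders in which
  \<open>S\<close> is comeager can be met simultaneously; the union of these cylinders is open, and
  dense by hypothesis.\<close>

lemma comeager_local:
  assumes "\<And>u. \<exists>w. comeager (- cyl (u @ w) \<union> S)"
  shows "comeager S"
proof -
  define V where "V = {v. comeager (- cyl v \<union> S)}"
  have "comeager (\<Inter>v. if v \<in> V then - cyl v \<union> S else UNIV)"
    by (rule comeager_INT) (auto simp: V_def comeager_UNIV)
  moreover have "comeager (\<Union>v\<in>V. cyl v)"
  proof (rule comeager_dense)
    fix u
    show "\<exists>w. cyl (u @ w) \<subseteq> (\<Union>v\<in>V. cyl v)"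
      using assms[of u] by (auto simp: V_def)
  qed
  ultimately show ?thesis
    by (rule comeager_mono[OF comeager_Int]) (auto split: if_splits)
qed

text \<open>On the cylinder of a string at least as long as \<open>u\<close>, \<open>graft u\<close>
  only replaces that string by another, so preimages of dense open sets still contain a cylinder
  below every string.\<close>

lemma comeager_graft:
  assumes "comeager S"
  shows "comeager {x. \<forall>u. graft u x \<in> S}"
proof -
  obtain D :: "nat \<Rightarrow> (nat \<Rightarrow> bool) set"
    where D: "\<And>n u. \<exists>w. cyl (u @ w) \<subseteq> D n" "(\<Inter>n. D n) \<subseteq> S"
    using assms unfolding comeager_def by metis
  have "comeager {x. graft u x \<in> D n}" for u n
  proof (rule comeager_dense)
    fix v
    define v' where "v' = v @ replicate (length u) True"
    obtain w where w: "cyl ((u @ drop (length u) v') @ w) \<subseteq> D n"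
      using D(1) by blast
    have "length u \<le> length v'"
      by (simp add: v'_def)
    then have "graft u x \<in> cyl ((u @ drop (length u) v') @ w)" if "x \<in> cyl (v' @ w)" for x
      using graft_append_cyl[of x "take (length u) v'" "drop (length u) v' @ w" u] that
      by (simp flip: append_assoc)
    then have "cyl (v @ replicate (length u) True @ w) \<subseteq> {x. graft u x \<in> D n}"
      using w by (auto simp: v'_def)
    then show "\<exists>w. cyl (v @ w) \<subseteq> {x. graft u x \<in> D n}"
      by blast
  qed
  then have "comeager (\<Inter>u. \<Inter>n. {x. graft u x \<in> D n})"
    by (intro comeager_INT)
  then show ?thesis
    by (rule comeager_mono) (use D(2) in blast)
qed

subsection \<open>Analytic sets have the Baire property\<close>

text \<open>Densely many cylinders decide \<open>S\<close> up to a meager set; this amounts to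
  \<open>S\<close> differing from an open set by a meager set.\<close>

definition baire_property :: "(nat \<Rightarrow> bool) set \<Rightarrow> bool" where
  "baire_property S \<longleftrightarrow>
    (\<forall>u. \<exists>w. comeager (- cyl (u @ w) \<union> S) \<or> comeager (- cyl (u @ w) \<union> - S))"

text \<open>Remove from each deciding cylinder the meager set of exceptions, and keep only points
  having a deciding cylinder for every \<open>i\<close>. On what remains, every \<open>S i\<close>
  is relatively clopen.\<close>

lemma comeager_deciding:
  fixes S :: "'i::countable \<Rightarrow> (nat \<Rightarrow> bool) set"
  assumes "\<And>i. baire_property (S i)"
  shows "\<exists>G. comeager G \<and>
    (\<forall>x\<in>G. \<forall>i. \<exists>n. \<forall>y\<in>G \<inter> cyl (map x [0..<n]). y \<in> S i \<longleftrightarrow> x \<in> S i)"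
proof -
  define V where "V i = {v. comeager (- cyl v \<union> S i)}" for i
  define V' where "V' i = {v. comeager (- cyl v \<union> - S i)}" for i
  define G where "G = (\<Inter>i. \<Inter>v. if v \<in> V i then - cyl v \<union> S i else UNIV) \<inter>
    (\<Inter>i. \<Inter>v. if v \<in> V' i then - cyl v \<union> - S i else UNIV) \<inter>
    (\<Inter>i. \<Union>v\<in>V i \<union> V' i. cyl v)"
  have "comeager G"
    unfolding G_def
  proof (intro comeager_Int comeager_INT)
    fix i
    show "comeager (\<Union>v\<in>V i \<union> V' i. cyl v)"
    proof (rule comeager_dense)
      fix u
      show "\<exists>w. cyl (u @ w) \<subseteq> (\<Union>v\<in>V i \<union> V' i. cyl v)"
        using assms[of i] unfolding baire_property_def V_def V'_def by blast
    qed
  qed (auto simp: V_def V'_def comeager_UNIV)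
  moreover have "\<exists>n. \<forall>y\<in>G \<inter> cyl (map x [0..<n]). y \<in> S i \<longleftrightarrow> x \<in> S i" if x: "x \<in> G" for x i
  proof -
    obtain v where v: "v \<in> V i \<union> V' i" "x \<in> cyl v"
      using x unfolding G_def by blast
    have "map x [0..<length v] = v"
      using v(2) by (simp add: cyl_iff)
    moreover have pos: "y \<in> S i" if "v \<in> V i" "y \<in> G" "y \<in> cyl v" for y
    proof -
      have "y \<in> (if v \<in> V i then - cyl v \<union> S i else UNIV)"
        using that(2) unfolding G_def by blast
      then show ?thesis using that by simp
    qed
    moreover have neg: "y \<notin> S i" if "v \<in> V' i" "y \<in> G" "y \<in> cyl v" for y
    proof -
      have "y \<in> (if v \<in> V' i then - cyl v \<union> - S i else UNIV)"
        using that(2) unfolding G_def by blast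
      then show ?thesis using that by simp
    qed
    ultimately show ?thesis
      using v x by (intro exI[of _ "length v"]) auto
  qed
  ultimately show ?thesis by blast
qed

text \<open>
  The hypothesis on \<open>R\<close> says that it is closed. The strings \<open>u\<close> with \<open>everywhere_nonmeager t u\<close>
  generate the regular open set on which the projection of \<open>R\<close> restricted to \<open>cyl t\<close> is
  nowhere meager; a generic point of it can follow one of the countably many extensions of \<open>t\<close> by
  one letter, and the sequence so produced is a witness because \<open>R\<close> is closed.
\<close>

lemma baire_property_projection:
  fixes R :: "((nat \<Rightarrow> bool) \<times> (nat \<Rightarrow> 'b::countable)) set"
  assumes closed: "\<And>x c. (\<And>n. \<exists>y\<in>cyl (map x [0..<n]). \<exists>d\<in>cyl (map c [0..<n]). (y, d) \<in> R)
    \<Longrightarrow> (x, c) \<in> R"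
  shows "baire_property (fst ` R)"
proof -
  define P where "P t = {x. \<exists>c\<in>cyl t. (x, c) \<in> R}" for t
  define everywhere_nonmeager
    where "everywhere_nonmeager t u \<longleftrightarrow> (\<forall>w. \<not> comeager (- cyl (u @ w) \<union> - P t))" for t u
  have P_Nil: "P [] = fst ` R"
    by (force simp: P_def cyl_def)
  have P_Un: "P t = (\<Union>i. P (t @ [i]))" for t
  proof -
    have "\<exists>i. c \<in> cyl (t @ [i])" if "c \<in> cyl t" for c
      using that
      by (intro exI[of _ "c (length t)"]) (auto simp: cyl_def nth_append less_Suc_eq)
    then show ?thesis
      using cyl_append by (fastforce simp: P_def)
  qed
  \<comment> \<open>Otherwise, for every \<open>i\<close>, each extension of \<open>u\<close> has a
    further one in which \<open>P (t @ [i])\<close> is meager. By localisation these sets, and hence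
    their countable union \<open>P t\<close>, are meager in \<open>cyl u\<close>, which is the first
    alternative with \<open>w = []\<close>.\<close>
  have split: "\<exists>w. comeager (- cyl (u @ w) \<union> - P t) \<or> (\<exists>i. everywhere_nonmeager (t @ [i]) (u @ w))"
    for t u
  proof (rule ccontr)
    assume contra: "\<not> ?thesis"
    have "comeager (- cyl u \<union> - P (t @ [i]))" for i
    proof (rule comeager_local)
      fix v
      \<comment> \<open>Padding makes the extension of \<open>v\<close> at least as long as
        \<open>u\<close>, so it either extends \<open>u\<close> or has a cylinder disjoint from that
        of \<open>u\<close>.\<close>
      show "\<exists>w. comeager (- cyl (v @ w) \<union> (- cyl u \<union> - P (t @ [i])))"
      proof (cases "prefix u (v @ replicate (length u) True)")
        case True
        then obtain w where w: "v @ replicate (length u) True = u @ w"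
          by (auto elim: prefixE)
        with contra obtain w' where "comeager (- cyl ((u @ w) @ w') \<union> - P (t @ [i]))"
          unfolding everywhere_nonmeager_def by blast
        then have "comeager (- cyl (v @ replicate (length u) True @ w') \<union> (- cyl u \<union> - P (t @ [i])))"
          by (rule comeager_mono) (auto simp flip: w)
        then show ?thesis by blast
      next
        case False
        have "x \<notin> cyl u" if "x \<in> cyl (v @ replicate (length u) True)" for x
          using cyl_Int_prefix[of x u] that False by auto
        then have "- cyl (v @ replicate (length u) True) \<union> (- cyl u \<union> - P (t @ [i])) = UNIV"
          by blast
        then show ?thesis
          using comeager_UNIV by (intro exI[of _ "replicate (length u) True"]) simp
      qed
    qed
    then have "comeager (\<Inter>i. - cyl u \<union> - P (t @ [i]))"
      by (rule comeager_INT)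
    then have "comeager (- cyl (u @ []) \<union> - P t)"
      by (rule comeager_mono) (auto simp: P_Un[of t])
    then show False
      using contra by blast
  qed
  define H where "H t = {x. \<exists>n. comeager (- cyl (map x [0..<n]) \<union> - P t) \<or>
    (\<exists>i. everywhere_nonmeager (t @ [i]) (map x [0..<n]))}" for t
  have "comeager (H t)" for t
  proof (rule comeager_dense)
    fix u
    obtain w where w: "comeager (- cyl (u @ w) \<union> - P t) \<or>
      (\<exists>i. everywhere_nonmeager (t @ [i]) (u @ w))"
      using split by blast
    have "cyl (u @ w) \<subseteq> H t"
    proof
      fix x assume "x \<in> cyl (u @ w)"
      then have "map x [0..<length (u @ w)] = u @ w"
        by (simp add: cyl_iff)
      with w show "x \<in> H t"
        unfolding H_def by (intro CollectI exI[of _ "length (u @ w)"]) simp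
    qed
    then show "\<exists>w. cyl (u @ w) \<subseteq> H t"
      by blast
  qed
  then have H: "comeager (\<Inter>t. H t)"
    by (rule comeager_INT)
  have follow: "x \<in> fst ` R" if x: "x \<in> (\<Inter>t. H t)" and u: "x \<in> cyl u" "everywhere_nonmeager [] u" for x u
  proof -
    let ?Q = "\<lambda>t. \<exists>n. everywhere_nonmeager t (map x [0..<n])"
    \<comment> \<open>Once \<open>?Q t\<close> holds, \<open>P t\<close> cannot be meager near
      \<open>x\<close>, so membership in \<open>H t\<close> must supply a next letter.\<close>
    have nonmeager: "\<not> comeager (- cyl (map x [0..<n]) \<union> - P t)" if Qt: "?Q t" for t n
    proof
      assume *: "comeager (- cyl (map x [0..<n]) \<union> - P t)"
      obtain k where k: "everywhere_nonmeager t (map x [0..<k])"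
        using Qt by auto
      have "map x [0..<n + k] = map x [0..<k] @ map x [k..<n + k]"
        using upt_add_eq_append[of 0 k n] by (simp add: add.commute)
      moreover have "comeager (- cyl (map x [0..<n + k]) \<union> - P t)"
        using * by (rule comeager_mono) (use cyl_initial_mono[of n "n + k" x] in auto)
      ultimately show False
        using k unfolding everywhere_nonmeager_def by metis
    qed
    have step: "\<exists>i. ?Q (t @ [i])" if "?Q t" for t
    proof -
      have "x \<in> H t"
        using x by blast
      then show ?thesis
        using nonmeager[OF that] unfolding H_def by blast
    qed
    have "\<exists>f. \<forall>k. (?Q (f k) \<and> length (f k) = k) \<and> (\<exists>i. f (Suc k) = f k @ [i])"
    proof (rule dependent_nat_choice)
      show "\<exists>t. ?Q t \<and> length t = 0"
        using u by (metis cyl_iff list.size(3))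
    next
      fix t k assume t: "?Q t \<and> length t = k"
      then obtain i where "?Q (t @ [i])"
        using step by blast
      then show "\<exists>t'. (?Q t' \<and> length t' = Suc k) \<and> (\<exists>i. t' = t @ [i])"
        using t by (intro exI[of _ "t @ [i]"]) auto
    qed
    then obtain f where f: "\<And>k. ?Q (f k)" "\<And>k. length (f k) = k" "\<And>k. \<exists>i. f (Suc k) = f k @ [i]"
      by blast
    have "strict_prefix (f k) (f (Suc k))" for k
      using f(3)[of k] by (auto simp: strict_prefix_def)
    then obtain c where c: "\<And>k. c \<in> cyl (f k)"
      using strict_prefix_chain_limit[of f] by blast
    have "(x, c) \<in> R"
    proof (rule closed)
      fix k
      have ck: "map c [0..<k] = f k"
        using c[of k] f(2)[of k] by (simp add: cyl_iff)
      \<comment> \<open>As \<open>P (f k)\<close> is not meager in the cylinder, it meets it; a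
        common point provides the required approximation to \<open>(x, c)\<close> in
        \<open>R\<close>.\<close>
      have "- cyl (map x [0..<k]) \<union> - P (f k) \<noteq> UNIV"
        using nonmeager[OF f(1)[of k], of k] comeager_UNIV by auto
      then show "\<exists>y\<in>cyl (map x [0..<k]). \<exists>d\<in>cyl (map c [0..<k]). (y, d) \<in> R"
        unfolding ck P_def by blast
    qed
    then show ?thesis by force
  qed
  show ?thesis
    unfolding baire_property_def
  proof
    fix u
    show "\<exists>w. comeager (- cyl (u @ w) \<union> fst ` R) \<or> comeager (- cyl (u @ w) \<union> - fst ` R)"
    proof (cases "everywhere_nonmeager [] u")
      case True
      have "comeager (- cyl (u @ []) \<union> fst ` R)"
        using H by (rule comeager_mono) (use follow True in auto)
      then show ?thesis by blast
    next
      case False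
      then show ?thesis
        unfolding everywhere_nonmeager_def P_Nil by blast
    qed
  qed
qed

section \<open>Closed and analytic sets in terms of cylinders\<close>

lemma tendsto_cyl:
  fixes x :: "nat \<Rightarrow> 'b::discrete_topology"
  assumes "\<And>n. f n \<in> cyl (map x [0..<n])"
  shows "f \<longlonglongrightarrow> x"
proof -
  have "(\<lambda>n. f n i) \<longlonglongrightarrow> x i" for i
  proof (rule tendsto_eventually)
    show "eventually (\<lambda>n. f n i = x i) sequentially"
      using eventually_gt_at_top[of i]
    proof eventually_elim
      case (elim n)
      then show ?case
        using assms[of n] by (simp add: cyl_def)
    qed
  qed
  then have "limitin (product_topology (\<lambda>_. euclidean) UNIV) f x sequentially"
    by (simp add: limitin_componentwise)
  then show ?thesis
    by (simp add: euclidean_product_topology)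
qed

lemma closed_Sigma11: "closed A \<Longrightarrow> Sigma11 A"
  unfolding Sigma11_def by (rule exI[of _ "A \<times> UNIV"]) (auto simp: closed_Times)

lemma Sigma11_vimage:
  fixes h :: "'a::topological_space \<Rightarrow> 'b::topological_space"
  assumes "Sigma11 A" and h: "continuous_on UNIV h"
  shows "Sigma11 (h -` A)"
proof -
  obtain C :: "('b \<times> (nat \<Rightarrow> nat)) set" where C: "closed C" "A = fst ` C"
    using assms(1) by (auto simp: Sigma11_def)
  have "closed ((\<lambda>z. (h (fst z), snd z)) -` C)"
    using C(1) by (rule closed_vimage) (intro continuous_intros continuous_on_compose2[OF h]; simp)
  moreover have "h -` A = fst ` ((\<lambda>z. (h (fst z), snd z)) -` C)"
  proof (intro equalityI subsetI)
    fix x assume "x \<in> h -` A"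
    then obtain b where "(h x, b) \<in> C"
      unfolding C(2) by auto
    then show "x \<in> fst ` ((\<lambda>z. (h (fst z), snd z)) -` C)"
      by (intro image_eqI[of _ _ "(x, b)"]) simp_all
  next
    fix x assume "x \<in> fst ` ((\<lambda>z. (h (fst z), snd z)) -` C)"
    then obtain b where "(h x, b) \<in> C"
      by auto
    then show "x \<in> h -` A"
      unfolding C(2) by (auto intro: rev_image_eqI)
  qed
  ultimately show ?thesis
    unfolding Sigma11_def by blast
qed

lemma continuous_on_graft:
  "continuous_on UNIV (graft t :: (nat \<Rightarrow> 'b::topological_space) \<Rightarrow> nat \<Rightarrow> 'b)"
proof (rule continuous_on_coordinatewise_then_product)
  show "continuous_on UNIV (\<lambda>x. graft t x i :: 'b)" for i
    by (cases "i < length t") (simp_all add: graft_def)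
qed

lemma cyl_comp: "d \<in> cyl (map c [0..<n]) \<Longrightarrow> g \<circ> d \<in> cyl (map (g \<circ> c) [0..<n])"
  by (simp add: cyl_def)

text \<open>The preimage is the projection of a closed set: a witness consists of the value
  \<open>y\<close>, a witness that \<open>(x, y)\<close> lies in the graph, and a witness that
  \<open>y\<close> lies in \<open>A\<close>. The three sequences are coded as one sequence of
  triples.\<close>

lemma baire_property_Delta11_vimage:
  fixes \<Phi> :: "(nat \<Rightarrow> bool) \<Rightarrow> nat \<Rightarrow> bool"
  assumes "Delta11_function \<Phi>" and "Sigma11 A"
  shows "baire_property (\<Phi> -` A)"
proof -
  obtain C1 :: "(((nat \<Rightarrow> bool) \<times> (nat \<Rightarrow> bool)) \<times> (nat \<Rightarrow> nat)) set"
    where C1: "closed C1" "{(x, y). y = \<Phi> x} = fst ` C1"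
    using assms(1) unfolding Delta11_function_def Delta11_def Sigma11_def by blast
  obtain C2 :: "((nat \<Rightarrow> bool) \<times> (nat \<Rightarrow> nat)) set" where C2: "closed C2" "A = fst ` C2"
    using assms(2) unfolding Sigma11_def by blast
  define R :: "((nat \<Rightarrow> bool) \<times> (nat \<Rightarrow> bool \<times> nat \<times> nat)) set"
    where "R = {(x, c). ((x, fst \<circ> c), (fst \<circ> snd) \<circ> c) \<in> C1 \<and> (fst \<circ> c, (snd \<circ> snd) \<circ> c) \<in> C2}"
  have "baire_property (fst ` R)"
  proof (rule baire_property_projection)
    fix x and c :: "nat \<Rightarrow> bool \<times> nat \<times> nat"
    assume "\<And>n. \<exists>y\<in>cyl (map x [0..<n]). \<exists>d\<in>cyl (map c [0..<n]). (y, d) \<in> R"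
    then obtain y d where y: "\<And>n. y n \<in> cyl (map x [0..<n])"
      and d: "\<And>n. d n \<in> cyl (map c [0..<n])" and R: "\<And>n. (y n, d n) \<in> R"
      by metis
    have lim: "y \<longlonglongrightarrow> x" "(\<lambda>n. fst \<circ> d n) \<longlonglongrightarrow> (fst \<circ> c)"
      "(\<lambda>n. (fst \<circ> snd) \<circ> d n) \<longlonglongrightarrow> ((fst \<circ> snd) \<circ> c)"
      "(\<lambda>n. (snd \<circ> snd) \<circ> d n) \<longlonglongrightarrow> ((snd \<circ> snd) \<circ> c)"
      by (rule tendsto_cyl, rule y) (rule tendsto_cyl, rule cyl_comp, rule d)+
    have "((x, fst \<circ> c), (fst \<circ> snd) \<circ> c) \<in> C1"
    proof (rule closed_sequentially[OF C1(1)])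
      show "((y n, fst \<circ> d n), (fst \<circ> snd) \<circ> d n) \<in> C1" for n
        using R[of n] unfolding R_def by simp
      show "(\<lambda>n. ((y n, fst \<circ> d n), (fst \<circ> snd) \<circ> d n)) \<longlonglongrightarrow> ((x, fst \<circ> c), (fst \<circ> snd) \<circ> c)"
        by (intro tendsto_Pair lim)
    qed
    moreover have "(fst \<circ> c, (snd \<circ> snd) \<circ> c) \<in> C2"
    proof (rule closed_sequentially[OF C2(1)])
      show "(fst \<circ> d n, (snd \<circ> snd) \<circ> d n) \<in> C2" for n
        using R[of n] unfolding R_def by simp
      show "(\<lambda>n. (fst \<circ> d n, (snd \<circ> snd) \<circ> d n)) \<longlonglongrightarrow> (fst \<circ> c, (snd \<circ> snd) \<circ> c)"
        by (intro tendsto_Pair lim)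
    qed
    ultimately show "(x, c) \<in> R"
      by (simp add: R_def)
  qed
  moreover have "fst ` R = \<Phi> -` A"
  proof (intro equalityI subsetI)
    fix x assume "x \<in> fst ` R"
    then obtain c where c: "((x, fst \<circ> c), (fst \<circ> snd) \<circ> c) \<in> C1" "(fst \<circ> c, (snd \<circ> snd) \<circ> c) \<in> C2"
      by (auto simp: R_def)
    have "(x, fst \<circ> c) \<in> fst ` C1" "fst \<circ> c \<in> fst ` C2"
      using imageI[OF c(1), of fst] imageI[OF c(2), of fst] by simp_all
    then show "x \<in> \<Phi> -` A"
      unfolding C1(2)[symmetric] C2(2)[symmetric] by simp
  next
    fix x assume "x \<in> \<Phi> -` A"
    then have "(x, \<Phi> x) \<in> fst ` C1" "\<Phi> x \<in> fst ` C2"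
      unfolding C1(2)[symmetric] C2(2)[symmetric] by simp_all
    then obtain a b where "((x, \<Phi> x), a) \<in> C1" "(\<Phi> x, b) \<in> C2"
      by auto
    then have "(x, \<lambda>i. (\<Phi> x i, a i, b i)) \<in> R"
      by (simp add: R_def o_def)
    then show "x \<in> fst ` R"
      by force
  qed
  ultimately show ?thesis by simp
qed

subsection \<open>Reductions that are continuous on a comeager set\<close>

text \<open>Differing from \<open>x\<close> somewhere past \<open>n\<close> is an open dense
  condition. Hence every cylinder contains inequivalent generic points.\<close>

lemma comeager_not_E0: "comeager {y. (x, y) \<notin> E0}"
proof -
  have "comeager (\<Inter>n. {y. \<exists>k>n. x k \<noteq> y k})"
  proof (intro comeager_INT comeager_dense)
    fix n and u :: "bool list"
    define k where "k = length u + Suc n"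
    have "y k = (\<not> x k)" if "y \<in> cyl (u @ replicate (Suc n) True @ [\<not> x k])" for y
      using that by (auto simp: cyl_def nth_append k_def)
    moreover have "n < k"
      by (simp add: k_def)
    ultimately have "cyl (u @ replicate (Suc n) True @ [\<not> x k]) \<subseteq> {y. \<exists>k>n. x k \<noteq> y k}"
      by fastforce
    then show "\<exists>w. cyl (u @ w) \<subseteq> {y. \<exists>k>n. x k \<noteq> y k}"
      by blast
  qed
  then show ?thesis
    by (rule comeager_mono) (auto simp: E0_def)
qed

lemma graft_graft_drop: "graft v (graft u x) = graft (v @ drop (length v) u) x"
  by (simp add: graft_def fun_eq_iff nth_append) auto

lemma graft_cyl_initial: "y \<in> cyl (map x [0..<n]) \<Longrightarrow> graft b y \<in> cyl (map (graft b x) [0..<n])"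
  by (simp add: cyl_def graft_def)

text \<open>The strings of \<open>F\<close> are handled one at a time; later extensions only shrink
  cylinders already inside \<open>D\<close>. The fusion needs a common extension because all nodes
  of a level are extended alike.\<close>

lemma dense_finite_extension:
  assumes "finite F" and dense: "\<And>u. \<exists>w. cyl (u @ w) \<subseteq> D"
  shows "\<exists>w'. \<forall>a\<in>F. cyl (a @ w @ w') \<subseteq> D"
  using assms(1)
proof induction
  case (insert b F)
  then obtain w1 where w1: "\<forall>a\<in>F. cyl (a @ w @ w1) \<subseteq> D"
    by blast
  obtain w2 where w2: "cyl ((b @ w @ w1) @ w2) \<subseteq> D"
    using dense by blast
  have "cyl (a @ w @ w1 @ w2) \<subseteq> D" if "a \<in> F" for a
    using w1 that cyl_append[of "a @ w @ w1" w2] by force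
  then show ?case
    using w2 by (intro exI[of _ "w1 @ w2"]) auto
qed simp

text \<open>Closure under grafting makes \<open>G\<close> a union of \<open>E0\<close>-classes, so
  continuity on \<open>G\<close> stays available after any change of finitely many digits.\<close>

locale generic_reduction =
  fixes \<Phi> :: "(nat \<Rightarrow> bool) \<Rightarrow> nat \<Rightarrow> bool" and G :: "(nat \<Rightarrow> bool) set"
  assumes comeager: "comeager G"
    and graft_G: "\<And>x u. x \<in> G \<Longrightarrow> graft u x \<in> G"
    and continuous: "\<And>x i. x \<in> G \<Longrightarrow> \<exists>n. \<forall>y\<in>G \<inter> cyl (map x [0..<n]). \<Phi> y i = \<Phi> x i"
    and reduction: "\<And>x y. (x, y) \<in> E0 \<longleftrightarrow> (\<Phi> x, \<Phi> y) \<in> E0"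
begin

lemma continuous_initial:
  assumes "x \<in> G"
  shows "\<exists>n\<ge>m. \<forall>y\<in>G \<inter> cyl (map x [0..<n]). \<forall>i<k. \<Phi> y i = \<Phi> x i"
proof (induction k)
  case (Suc k)
  then obtain n where n: "n \<ge> m" "\<forall>y\<in>G \<inter> cyl (map x [0..<n]). \<forall>i<k. \<Phi> y i = \<Phi> x i"
    by blast
  obtain n' where n': "\<forall>y\<in>G \<inter> cyl (map x [0..<n']). \<Phi> y k = \<Phi> x k"
    using continuous[OF assms] by blast
  have "\<forall>y\<in>G \<inter> cyl (map x [0..<n + n']). \<forall>i<Suc k. \<Phi> y i = \<Phi> x i"
  proof (intro ballI allI impI)
    fix y i assume y: "y \<in> G \<inter> cyl (map x [0..<n + n'])" and i: "i < Suc k"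
    have "y \<in> G \<inter> cyl (map x [0..<n])" "y \<in> G \<inter> cyl (map x [0..<n'])"
      using y cyl_initial_mono[of n "n + n'" x] cyl_initial_mono[of n' "n + n'" x] by auto
    with n(2) n' i show "\<Phi> y i = \<Phi> x i"
      by (cases "i = k") auto
  qed
  with n(1) show ?case
    by (intro exI[of _ "n + n'"]) simp
qed auto

text \<open>Two inequivalent points of \<open>G\<close> in \<open>cyl a\<close> have images
  differing somewhere past \<open>K\<close>; by continuity, long initial segments of the two points
  force that digit.\<close>

lemma split_digit:
  "\<exists>w i. K \<le> i \<and> length (w False) = length (w True) \<and> (\<forall>j. w j \<noteq> []) \<and>
    (\<forall>x\<in>G. \<forall>j. \<Phi> (graft (a @ w j) x) i = j)"
proof -
  obtain x where x: "x \<in> G" "x \<in> cyl a"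
    using comeager_meets_cyl[OF comeager] by blast
  obtain y where y: "y \<in> G" "y \<in> cyl a" "(x, y) \<notin> E0"
    using comeager_meets_cyl[OF comeager_Int[OF comeager comeager_not_E0]] by blast
  have "(\<Phi> x, \<Phi> y) \<notin> E0"
    using y(3) reduction by blast
  then obtain i where i: "i > K" "\<Phi> x i \<noteq> \<Phi> y i"
    unfolding E0_def by blast
  \<comment> \<open>\<open>z j\<close> is the one of the two points whose image has digit
    \<open>j\<close> at position \<open>i\<close>.\<close>
  define z where "z j = (if \<Phi> x i = j then x else y)" for j
  have z: "z j \<in> G" "z j \<in> cyl a" "\<Phi> (z j) i = j" for j
    using x y i(2) by (auto simp: z_def)
  have "\<exists>n. \<forall>y\<in>G \<inter> cyl (map (z j) [0..<n]). \<Phi> y i = \<Phi> (z j) i" for j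
    using z(1) by (rule continuous)
  then obtain N where N: "\<And>j. \<forall>y\<in>G \<inter> cyl (map (z j) [0..<N j]). \<Phi> y i = \<Phi> (z j) i"
    by metis
  define M where "M = N False + N True + Suc (length a)"
  define w where "w j = drop (length a) (map (z j) [0..<M])" for j
  have aw: "a @ w j = map (z j) [0..<M]" for j
    using initial_extends[OF z(2)[of j], of M] unfolding w_def M_def by simp
  have "N j \<le> M" for j
    by (cases j) (simp_all add: M_def)
  then have "graft (a @ w j) x \<in> G \<inter> cyl (map (z j) [0..<N j])" if "x \<in> G" for x j
    using graft_G[OF that] cyl_initial_mono[of "N j" M "z j"] graft_in_cyl[of "a @ w j" x]
    unfolding aw by auto
  then have "\<Phi> (graft (a @ w j) x) i = j" if "x \<in> G" for x j
    using N[of j] z(3)[of j] that by blast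
  moreover have len_w: "length (w j) = M - length a" for j
    by (simp add: w_def)
  moreover have "w j \<noteq> []" for j
    unfolding length_greater_0_conv[symmetric] len_w by (simp add: M_def)
  ultimately show ?thesis
    using i(1) by (intro exI[of _ w] exI[of _ i]) simp
qed

text \<open>The two grafts are \<open>E0\<close>-equivalent, so their images agree from some digit
  on. If no bound were uniform on a cylinder, the points with a disagreement past every
  \<open>k\<close> would be comeager, and one of them would lie in \<open>G\<close>.\<close>

lemma agree_from:
  "\<exists>b k. \<forall>x\<in>G \<inter> cyl b. \<forall>j\<ge>k. \<Phi> (graft u x) j = \<Phi> (graft v x) j"
proof (rule ccontr)
  assume contra: "\<not> ?thesis"
  define B where "B k = {x. x \<in> G \<longrightarrow> (\<exists>j\<ge>k. \<Phi> (graft u x) j \<noteq> \<Phi> (graft v x) j)}" for k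
  have "comeager (B k)" for k
  proof (rule comeager_dense)
    fix b
    obtain x j where x: "x \<in> G" "x \<in> cyl b" and j: "j \<ge> k" "\<Phi> (graft u x) j \<noteq> \<Phi> (graft v x) j"
      using contra by blast
    obtain n1 where n1: "\<forall>y\<in>G \<inter> cyl (map (graft u x) [0..<n1]). \<Phi> y j = \<Phi> (graft u x) j"
      using continuous[OF graft_G[OF x(1)]] by blast
    obtain n2 where n2: "\<forall>y\<in>G \<inter> cyl (map (graft v x) [0..<n2]). \<Phi> y j = \<Phi> (graft v x) j"
      using continuous[OF graft_G[OF x(1)]] by blast
    define n where "n = n1 + n2 + length b"
    have "y \<in> B k" if y: "y \<in> cyl (map x [0..<n])" for y
      unfolding B_def
    proof (intro CollectI impI)
      assume G: "y \<in> G"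
      have "graft u y \<in> cyl (map (graft u x) [0..<n1])"
        using graft_cyl_initial[OF y] cyl_initial_mono[of n1 n "graft u x"] by (auto simp: n_def)
      moreover have "graft v y \<in> cyl (map (graft v x) [0..<n2])"
        using graft_cyl_initial[OF y] cyl_initial_mono[of n2 n "graft v x"] by (auto simp: n_def)
      ultimately have "\<Phi> (graft u y) j = \<Phi> (graft u x) j" "\<Phi> (graft v y) j = \<Phi> (graft v x) j"
        using n1 n2 graft_G[OF G] by blast+
      with j show "\<exists>j\<ge>k. \<Phi> (graft u y) j \<noteq> \<Phi> (graft v y) j"
        by auto
    qed
    moreover have "map x [0..<n] = b @ drop (length b) (map x [0..<n])"
      using x(2) by (rule initial_extends) (simp add: n_def)
    ultimately show "\<exists>w. cyl (b @ w) \<subseteq> B k"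
      by (metis subsetI)
  qed
  then have "comeager (\<Inter>k. B k)"
    by (rule comeager_INT)
  then obtain x where x: "x \<in> G" "\<And>k. x \<in> B k"
    using comeager_meets_cyl[OF comeager_Int[OF comeager], of "\<Inter>k. B k"] by blast
  have "(graft u x, graft v x) \<in> E0"
    using E0_trans[OF graft_E0 E0_sym[OF graft_E0]] .
  then have "(\<Phi> (graft u x), \<Phi> (graft v x)) \<in> E0"
    using reduction by blast
  then obtain n where "\<forall>k>n. \<Phi> (graft u x) k = \<Phi> (graft v x) k"
    unfolding E0_def by blast
  moreover obtain j where "j \<ge> Suc n" "\<Phi> (graft u x) j \<noteq> \<Phi> (graft v x) j"
    using x(2)[of "Suc n"] x(1) unfolding B_def by blast
  ultimately show False
    by simp
qed

lemma stabilise: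
  fixes b :: "bool \<Rightarrow> bool list"
  shows "\<exists>w z. \<forall>x\<in>G \<inter> cyl (c @ w). \<forall>j. \<forall>i<k. \<Phi> (graft (b j) x) i = z j i"
proof -
  obtain x where x: "x \<in> G" "x \<in> cyl c"
    using comeager_meets_cyl[OF comeager] by blast
  have "\<exists>n. \<forall>y\<in>G \<inter> cyl (map (graft (b j) x) [0..<n]). \<forall>i<k. \<Phi> y i = \<Phi> (graft (b j) x) i" for j
    using continuous_initial[OF graft_G[OF x(1)]] by blast
  then obtain N where N: "\<And>j. \<forall>y\<in>G \<inter> cyl (map (graft (b j) x) [0..<N j]).
      \<forall>i<k. \<Phi> y i = \<Phi> (graft (b j) x) i"
    by metis
  define n where "n = N False + N True + length c"
  have "\<Phi> (graft (b j) y) i = \<Phi> (graft (b j) x) i"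
    if y: "y \<in> G \<inter> cyl (map x [0..<n])" and "i < k" for y j i
  proof -
    have "N j \<le> n"
      by (cases j) (simp_all add: n_def)
    then have "graft (b j) y \<in> cyl (map (graft (b j) x) [0..<N j])"
      using y graft_cyl_initial[of y x n "b j"] cyl_initial_mono[of "N j" n "graft (b j) x"] by auto
    then show ?thesis
      using N[of j] y graft_G \<open>i < k\<close> by blast
  qed
  moreover have "map x [0..<n] = c @ drop (length c) (map x [0..<n])"
    using x(2) by (rule initial_extends) (simp add: n_def)
  ultimately show ?thesis
    by (intro exI[of _ "drop (length c) (map x [0..<n])"] exI[of _ "\<lambda>j. \<Phi> (graft (b j) x)"]) simp
qed

text \<open>The strings from \<open>split_digit\<close> force different digits. After a common
  extension \<open>q\<close> the two images consist of fixed initial strings of length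
  \<open>K\<close> followed by the same tail, so each arises from the other by a graft.\<close>

lemma split_step:
  assumes s: "\<And>x. x \<in> G \<Longrightarrow> \<Phi> (graft a x) \<in> cyl s"
    and F: "finite F" and dense: "\<And>u. \<exists>w. cyl (u @ w) \<subseteq> D"
  shows "\<exists>w e :: bool \<Rightarrow> bool list.
    length (w False) = length (w True) \<and> length (e False) = length (e True) \<and>
    (\<forall>j. w j \<noteq> []) \<and> (\<exists>r p. \<forall>j. e j = r @ [j] @ p j) \<and>
    (\<forall>x\<in>G. \<forall>i j. \<Phi> (graft (a @ w i) x) = graft (s @ e i) (\<Phi> (graft (a @ w j) x))) \<and>
    (\<forall>b\<in>F. \<forall>j. cyl (b @ w j) \<subseteq> D)"
proof -
  obtain w i where i: "length s \<le> i" and w: "length (w False) = length (w True)" "\<And>j. w j \<noteq> []"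
    and digit: "\<And>x j. x \<in> G \<Longrightarrow> \<Phi> (graft (a @ w j) x) i = j"
    using split_digit[of "length s" a] by blast
  obtain b k where agree:
    "\<And>x l. x \<in> G \<inter> cyl b \<Longrightarrow> l \<ge> k \<Longrightarrow> \<Phi> (graft (a @ w False) x) l = \<Phi> (graft (a @ w True) x) l"
    using agree_from[of "a @ w False" "a @ w True"] by blast
  define L where "L = length (a @ w False)"
  have L: "length (a @ w j) = L" for j
    using w(1) by (cases j) (simp_all add: L_def)
  \<comment> \<open>Padding brings \<open>c\<close> past the first \<open>L\<close> digits, which
    \<open>a @ w j\<close> overwrites; the remainder of \<open>c @ w1\<close> becomes
    \<open>q1\<close>.\<close>
  define c where "c = b @ replicate L True"
  \<comment> \<open>\<open>K\<close> lies past the splitting digit \<open>i\<close> and is at least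
    the bound \<open>k\<close> from which the images agree.\<close>
  define K where "K = max k (Suc i)"
  obtain w1 z where z: "\<And>x j i. x \<in> G \<inter> cyl (c @ w1) \<Longrightarrow> i < K \<Longrightarrow> \<Phi> (graft (a @ w j) x) i = z j i"
    using stabilise[of c K "\<lambda>j. a @ w j"] by blast
  define q1 where "q1 = drop L (c @ w1)"
  have "finite (\<Union>j. (\<lambda>b. b @ w j) ` F)"
    using F by simp
  then have "\<exists>w2. \<forall>a\<in>\<Union>j. (\<lambda>b. b @ w j) ` F. cyl (a @ q1 @ w2) \<subseteq> D"
    using dense by (rule dense_finite_extension)
  then obtain w2 where "\<forall>a\<in>\<Union>j. (\<lambda>b. b @ w j) ` F. cyl (a @ q1 @ w2) \<subseteq> D"
    by (rule exE)
  then have w2: "cyl ((b @ w j) @ q1 @ w2) \<subseteq> D" if "b \<in> F" for b j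
    using that by blast
  define q where "q = q1 @ w2"
  \<comment> \<open>Grafting \<open>a @ w j @ q\<close> amounts to moving into \<open>cyl b\<close>
    first and then overwriting \<open>L\<close> digits, so \<open>agree\<close> and \<open>z\<close>
    can be applied to \<open>g x\<close>.\<close>
  define g where "g x = graft (c @ w1 @ w2) x" for x :: "nat \<Rightarrow> bool"
  have g: "graft (a @ w j @ q) x = graft (a @ w j) (g x)" for j x
    using graft_graft_drop[of "a @ w j" "c @ w1 @ w2" x] unfolding L q_def q1_def g_def
    by (simp add: c_def)
  have gG: "g x \<in> G" "g x \<in> cyl (c @ w1)" "g x \<in> cyl b" if "x \<in> G" for x
  proof -
    show "g x \<in> G"
      unfolding g_def using that by (rule graft_G)
    have "g x \<in> cyl (c @ w1 @ w2)"
      unfolding g_def by simp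
    then show "g x \<in> cyl (c @ w1)" "g x \<in> cyl b"
      using cyl_append[of "c @ w1" w2] cyl_append[of b "replicate L True @ w1 @ w2"]
      unfolding c_def by auto
  qed
  define t where "t j = map (z j) [0..<K]" for j
  define e where "e j = drop (length s) (t j)" for j
  have sK: "length s \<le> K"
    using i by (simp add: K_def)
  have t: "\<Phi> (graft (a @ w j @ q) x) \<in> cyl (t j)" if "x \<in> G" for j x
    using z[of "g x" _ j] gG[OF that] unfolding g t_def by (simp add: cyl_def)
  have se: "s @ e j = t j" for j
  proof -
    obtain x where x: "x \<in> G"
      using comeager_meets_cyl[OF comeager] by blast
    have "\<Phi> (graft (a @ w j @ q) x) \<in> cyl s"
      using s[OF graft_G[OF x, of "a @ w j @ q"]]
      by (simp add: graft_graft_drop)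
    then have "prefix s (t j)"
      using cyl_Int_prefix[OF _ t[OF x]] sK by (simp add: t_def)
    then show ?thesis
      by (auto simp: e_def elim!: prefixE)
  qed
  have same: "\<Phi> (graft (a @ w j @ q) x) l = \<Phi> (graft (a @ w j' @ q) x) l"
    if "x \<in> G" "l \<ge> K" for j j' x l
    using agree[of "g x" l] gG[OF that(1)] that(2) unfolding g K_def
    by (cases j; cases j') auto
  have main: "\<Phi> (graft (a @ w j @ q) x) = graft (s @ e j) (\<Phi> (graft (a @ w j' @ q) x))"
    if "x \<in> G" for j j' x
  proof
    fix l
    have "length (t j) = K"
      by (simp add: t_def)
    then show "\<Phi> (graft (a @ w j @ q) x) l = graft (s @ e j) (\<Phi> (graft (a @ w j' @ q) x)) l"
      using t[OF that, of j] same[OF that, of l j j'] unfolding se graft_def cyl_def by simp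
  qed
  have len_e: "length (e j) = K - length s" for j
    by (simp add: e_def t_def)
  have "e False \<noteq> e True"
  proof
    assume "e False = e True"
    then have "t False = t True"
      using se by metis
    obtain x where x: "x \<in> G"
      using comeager_meets_cyl[OF comeager] by blast
    have "i < K"
      by (simp add: K_def)
    have "t j ! i = j" for j
      using t[OF x, of j] digit[OF gG(1)[OF x], of j] \<open>i < K\<close> unfolding g by (simp add: cyl_def t_def)
    then show False
      using \<open>t False = t True\<close> by metis
  qed
  then obtain r d pF d' pT where e: "d \<noteq> d'" "e False = r @ [d] @ pF" "e True = r @ [d'] @ pT"
    using same_length_different[of "e False" "e True"] len_e by auto
  text \<open>\<open>\<sigma>\<close> exchanges the two extensions if the first digit where they differ is the wrong one.\<close>
  define \<sigma> where "\<sigma> j = (j \<noteq> d)" for j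
  have e\<sigma>: "e (\<sigma> j) = r @ [j] @ (if \<sigma> j then pT else pF)" for j
    using e by (cases j; cases d) (auto simp: \<sigma>_def)
  have "\<exists>r p. \<forall>j. e (\<sigma> j) = r @ [j] @ p j"
    using e\<sigma> by (intro exI[of _ r] exI[of _ "\<lambda>j. if \<sigma> j then pT else pF"]) blast
  moreover have "length (w (\<sigma> False)) = length (w (\<sigma> True))"
    using w(1) by (cases "\<sigma> False"; cases "\<sigma> True") simp_all
  ultimately show ?thesis
    using main w(2) w2 len_e
    by (intro exI[of _ "\<lambda>j. w (\<sigma> j) @ q"] exI[of _ "\<lambda>j. e (\<sigma> j)"]) (auto simp: q_def)
qed

end

subsection \<open>Branches of trees and fusion\<close>

lemma E0_tree_node_Nil [simp]: "E0_tree_node s v [] = s"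
  by (simp add: E0_tree_node_def)

lemma E0_tree_node_snoc: "E0_tree_node s v (\<sigma> @ [j]) = E0_tree_node s v \<sigma> @ v (length \<sigma>) j"
proof -
  have "map (\<lambda>m. v m ((\<sigma> @ [j]) ! m)) [0..<length \<sigma>] = map (\<lambda>m. v m (\<sigma> ! m)) [0..<length \<sigma>]"
    by (rule map_cong) (simp_all add: nth_append)
  then show ?thesis
    by (simp add: E0_tree_node_def del: map_eq_conv)
qed

lemma E0_tree_node_stem: "E0_tree_node s v \<sigma> = s @ E0_tree_node [] v \<sigma>"
  by (simp add: E0_tree_node_def)

lemma prefix_E0_tree_node: "prefix (E0_tree_node s v \<sigma>) (E0_tree_node s v (\<sigma> @ \<tau>))"
proof (induction \<tau> rule: rev_induct)
  case (snoc j \<tau>)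
  then show ?case
    using E0_tree_node_snoc[of s v "\<sigma> @ \<tau>" j] by simp
qed simp

lemma length_E0_tree_node:
  assumes "\<And>m. length (v m False) = length (v m True)"
  shows "length \<sigma> = length \<tau> \<Longrightarrow> length (E0_tree_node s v \<sigma>) = length (E0_tree_node s v \<tau>)"
proof (induction \<sigma> arbitrary: \<tau> rule: rev_induct)
  case (snoc i \<sigma>)
  then obtain \<tau>' j where \<tau>: "\<tau> = \<tau>' @ [j]"
    by (cases \<tau> rule: rev_cases) auto
  have "length (v (length \<tau>') i) = length (v (length \<tau>') j)"
    using assms by (cases i; cases j) simp_all
  with snoc \<tau> show ?case
    by (simp add: E0_tree_node_snoc)
qed simp

lemma length_E0_tree_node_ge:
  assumes "\<And>m i. v m i \<noteq> []"
  shows "length \<sigma> \<le> length (E0_tree_node s v \<sigma>)"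
proof (induction \<sigma> rule: rev_induct)
  case (snoc i \<sigma>)
  then show ?case
    using assms[of "length \<sigma>" i] by (cases "v (length \<sigma>) i") (simp_all add: E0_tree_node_snoc)
qed simp

lemma cyl_append_Cons: "x \<in> cyl (u @ j # r) \<Longrightarrow> x (length u) = j"
  unfolding cyl_def by (drule CollectD, drule spec[of _ "length u"]) simp

text \<open>All nodes of level \<open>m\<close> have the same length \<open>L m\<close>, and
  \<open>v m j\<close> starts with \<open>j\<close>; the path of \<open>x\<close> through the tree
  is therefore read off as \<open>\<alpha> m = x (L m)\<close>.\<close>

lemma branches_E0_tree:
  assumes p: "is_E0_tree p s v" and x: "x \<in> branches p"
  shows "\<exists>\<alpha>. \<forall>m. x \<in> cyl (E0_tree_node s v (map \<alpha> [0..<m]))"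
proof -
  let ?N = "E0_tree_node s v"
  have first: "prefix [i] (v m i)" for m i
    using p unfolding is_E0_tree_def by blast
  have len: "length (v m False) = length (v m True)" for m
    using p unfolding is_E0_tree_def by blast
  have p_eq: "p = {t. \<exists>\<sigma>. prefix t (?N \<sigma>)}"
    using p unfolding is_E0_tree_def by blast
  define L where "L m = length (?N (replicate m False))" for m
  have length_N: "length (?N \<sigma>) = L (length \<sigma>)" for \<sigma>
    unfolding L_def using len by (rule length_E0_tree_node) simp
  have "L m < L (Suc m)" for m
    using first[of False m] unfolding L_def replicate_append_same[symmetric] replicate_Suc
    by (auto simp: E0_tree_node_snoc elim!: prefixE)
  then have L_mono: "strict_mono L"
    by (rule strict_mono_Suc_iff[THEN iffD2, OF allI])
  have digit: "\<sigma> ! i = x (L i)" if \<sigma>: "x \<in> cyl (?N \<sigma>)" and i: "i < length \<sigma>" for \<sigma> i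
  proof -
    obtain r where r: "v i (\<sigma> ! i) = \<sigma> ! i # r"
      using first[of "\<sigma> ! i" i] by (auto elim!: prefixE)
    have "?N (take (Suc i) \<sigma>) = ?N (take i \<sigma>) @ \<sigma> ! i # r"
      using i E0_tree_node_snoc[of s v "take i \<sigma>" "\<sigma> ! i"] r by (simp add: take_Suc_conv_app_nth)
    moreover have "x \<in> cyl (?N (take (Suc i) \<sigma>))"
      using \<sigma> prefix_E0_tree_node[of s v "take (Suc i) \<sigma>" "drop (Suc i) \<sigma>"] cyl_prefix by auto
    ultimately have "x (length (?N (take i \<sigma>))) = \<sigma> ! i"
      using cyl_append_Cons by metis
    then show ?thesis
      using i by (simp add: length_N)
  qed
  have "x \<in> cyl (?N (map (\<lambda>i. x (L i)) [0..<m]))" for m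
  proof -
    \<comment> \<open>This initial segment is a prefix of some node \<open>?N \<sigma>\<close>, and
      comparing lengths identifies it with the node of level \<open>m\<close> on the way to
      \<open>?N \<sigma>\<close>.\<close>
    have "map x [0..<L m] \<in> p"
      using x by (simp add: branches_def)
    then obtain \<sigma> where \<sigma>: "prefix (map x [0..<L m]) (?N \<sigma>)"
      unfolding p_eq by blast
    have "L m \<le> L (length \<sigma>)"
      using prefix_length_le[OF \<sigma>] by (simp add: length_N)
    then have m: "m \<le> length \<sigma>"
      using L_mono by (simp add: strict_mono_less_eq)
    have "prefix (?N (take m \<sigma>)) (?N \<sigma>)"
      using prefix_E0_tree_node[of s v "take m \<sigma>" "drop m \<sigma>"] by simp
    moreover have len_take: "length (?N (take m \<sigma>)) = L m"
      using m by (simp add: length_N)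
    ultimately have "map x [0..<L m] = ?N (take m \<sigma>)"
      using \<sigma> by (intro prefix_order.antisym) (auto intro: prefix_length_prefix)
    then have cyl: "x \<in> cyl (?N (take m \<sigma>))"
      by (simp add: cyl_iff len_take)
    have "take m \<sigma> = map (\<lambda>i. x (L i)) [0..<m]"
    proof (rule nth_equalityI)
      fix i assume "i < length (take m \<sigma>)"
      then show "take m \<sigma> ! i = map (\<lambda>i. x (L i)) [0..<m] ! i"
        using digit[OF cyl, of i] m by simp
    qed (use m in simp)
    with cyl show ?thesis by simp
  qed
  then show ?thesis
    by (rule exI[of _ "\<lambda>i. x (L i)", OF allI])
qed

section \<open>The fusion construction\<close>

context generic_reduction
begin

text \<open>Strings for the arguments and for the values of \<open>\<Phi>\<close> are built level by
  level. Coherence lets one application of \<open>split_step\<close> serve a whole level, and the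
  sets \<open>D m\<close> keep the limit points in \<open>G\<close>.\<close>

lemma splitting_scheme:
  assumes s0: "\<And>x. x \<in> G \<Longrightarrow> \<Phi> (graft u0 x) \<in> cyl s0"
  obtains e :: "nat \<Rightarrow> bool \<Rightarrow> bool list"
  where "\<And>m. length (e m False) = length (e m True)"
    and "\<And>m. \<exists>r p. \<forall>j. e m j = r @ [j] @ p j"
    and "\<And>\<alpha>. \<exists>y\<in>G \<inter> cyl u0. \<forall>m. \<Phi> y \<in> cyl (E0_tree_node s0 e (map \<alpha> [0..<m]))"
proof -
  obtain D :: "nat \<Rightarrow> (nat \<Rightarrow> bool) set"
    where D: "\<And>n u. \<exists>w. cyl (u @ w) \<subseteq> D n" "(\<Inter>n. D n) \<subseteq> G"
    using comeager unfolding comeager_def by metis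
  \<comment> \<open>The case \<open>\<sigma> = \<tau>\<close> of the equation places values in
    \<open>cyl (s \<sigma>)\<close>; the other cases transport values between the nodes of level
    \<open>m\<close>.\<close>
  define coherent :: "nat \<Rightarrow> (bool list \<Rightarrow> bool list) \<times> (bool list \<Rightarrow> bool list) \<Rightarrow> bool"
    where "coherent m = (\<lambda>(a, s). \<forall>\<sigma> \<tau>. length \<sigma> = m \<longrightarrow> length \<tau> = m \<longrightarrow>
      length (a \<sigma>) = length (a \<tau>) \<and> length (s \<sigma>) = length (s \<tau>) \<and>
      (\<forall>x\<in>G. \<Phi> (graft (a \<sigma>) x) = graft (s \<sigma>) (\<Phi> (graft (a \<tau>) x))))" for m
  define good :: "(bool \<Rightarrow> bool list) \<Rightarrow> (bool \<Rightarrow> bool list) \<Rightarrow> bool"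
    where "good w e \<longleftrightarrow> length (e False) = length (e True) \<and>
      (\<forall>j. w j \<noteq> []) \<and> (\<exists>r p. \<forall>j. e j = r @ [j] @ p j)" for w e
  define extends :: "nat \<Rightarrow> (bool list \<Rightarrow> bool list) \<times> (bool list \<Rightarrow> bool list) \<Rightarrow>
      (bool list \<Rightarrow> bool list) \<times> (bool list \<Rightarrow> bool list) \<Rightarrow>
      (bool \<Rightarrow> bool list) \<Rightarrow> (bool \<Rightarrow> bool list) \<Rightarrow> bool"
    where "extends m st st' w e \<longleftrightarrow> good w e \<and>
      (\<forall>\<sigma>. length \<sigma> = m \<longrightarrow> (\<forall>j. fst st' (\<sigma> @ [j]) = fst st \<sigma> @ w j \<and>
        snd st' (\<sigma> @ [j]) = snd st \<sigma> @ e j \<and> cyl (fst st' (\<sigma> @ [j])) \<subseteq> D m))" for m st st' w e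
  \<comment> \<open>The clause for \<open>m = 0\<close> records the initial state, which dependent
    choice alone would not retain.\<close>
  have "\<exists>f. \<forall>m. (coherent m (f m) \<and> (m = 0 \<longrightarrow> f m = (\<lambda>_. u0, \<lambda>_. s0))) \<and>
    (\<exists>w e. extends m (f m) (f (Suc m)) w e)"
  proof (rule dependent_nat_choice)
    show "\<exists>st. coherent 0 st \<and> (0 = (0::nat) \<longrightarrow> st = (\<lambda>_. u0, \<lambda>_. s0))"
      using s0 by (auto simp: coherent_def graft_id)
  next
    fix st m assume st: "coherent m st \<and> (m = 0 \<longrightarrow> st = (\<lambda>_. u0, \<lambda>_. s0))"
    obtain a s where as: "st = (a, s)"
      by (cases st)
    have cm: "coherent m (a, s)"
      using st as by simp
    have len: "length (a \<sigma>) = length (a \<tau>)" "length (s \<sigma>) = length (s \<tau>)"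
      if "length \<sigma> = m" "length \<tau> = m" for \<sigma> \<tau>
      using cm that unfolding coherent_def prod.case by blast+
    have coh: "\<Phi> (graft (a \<sigma>) x) = graft (s \<sigma>) (\<Phi> (graft (a \<tau>) x))"
      if "length \<sigma> = m" "length \<tau> = m" "x \<in> G" for \<sigma> \<tau> x
      using cm that unfolding coherent_def prod.case by blast
    \<comment> \<open>It is enough to split one node of the level, here the all-\<open>False\<close>
      one.\<close>
    define zs where "zs = replicate m False"
    have zs: "length zs = m"
      by (simp add: zs_def)
    have "\<Phi> (graft (a zs) x) \<in> cyl (s zs)" if "x \<in> G" for x
      using graft_in_cyl[of "s zs" "\<Phi> (graft (a zs) x)"] unfolding coh[OF zs zs that, symmetric] .
    moreover have "finite (a ` {\<sigma>. length \<sigma> = m})"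
      using finite_lists_length_eq[of "UNIV :: bool set" m] by simp
    ultimately have "\<exists>w e :: bool \<Rightarrow> bool list.
      length (w False) = length (w True) \<and> length (e False) = length (e True) \<and>
      (\<forall>j. w j \<noteq> []) \<and> (\<exists>r p. \<forall>j. e j = r @ [j] @ p j) \<and>
      (\<forall>x\<in>G. \<forall>i j. \<Phi> (graft (a zs @ w i) x) = graft (s zs @ e i) (\<Phi> (graft (a zs @ w j) x))) \<and>
      (\<forall>b\<in>a ` {\<sigma>. length \<sigma> = m}. \<forall>j. cyl (b @ w j) \<subseteq> D m)"
      using D(1)[where n = m] by (rule split_step)
    then obtain w e :: "bool \<Rightarrow> bool list"
      where w: "length (w False) = length (w True)" and good: "good w e"
        and we: "\<And>x i j. x \<in> G \<Longrightarrow>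
          \<Phi> (graft (a zs @ w i) x) = graft (s zs @ e i) (\<Phi> (graft (a zs @ w j) x))"
        and Dm: "\<And>\<sigma> j. length \<sigma> = m \<Longrightarrow> cyl (a \<sigma> @ w j) \<subseteq> D m"
      unfolding good_def by blast
    have len_we: "length (w i) = length (w j)" "length (e i) = length (e j)" for i j
      using w good unfolding good_def by (cases i; cases j; simp)+
    define st' where "st' = (\<lambda>\<rho>. a (butlast \<rho>) @ w (last \<rho>), \<lambda>\<rho>. s (butlast \<rho>) @ e (last \<rho>))"
    have lift: "\<Phi> (graft (a \<sigma> @ w i) x) = graft (s \<sigma>) (\<Phi> (graft (a zs @ w i) x))"
      if "length \<sigma> = m" "x \<in> G" for \<sigma> i x
    proof -
      have "graft (a zs) (graft (a zs @ w i) x) = graft (a zs @ w i) x"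
        by (rule graft_graft_append) simp
      then show ?thesis
        using coh[OF that(1) zs graft_G[OF that(2), of "a zs @ w i"]]
          graft_graft_append[OF len(1)[OF that(1) zs], of "w i" x] by simp
    qed
    \<comment> \<open>Pass from \<open>\<sigma>\<close> to \<open>zs\<close>, split there, and
      insert \<open>s \<tau>\<close>, which the longer graft overwrites anyway, in order to reach
      \<open>\<tau>\<close>.\<close>
    have step: "\<Phi> (graft (a \<sigma> @ w i) x) = graft (s \<sigma> @ e i) (\<Phi> (graft (a \<tau> @ w j) x))"
      if "length \<sigma> = m" "length \<tau> = m" "x \<in> G" for \<sigma> \<tau> i j x
    proof -
      have "\<Phi> (graft (a \<sigma> @ w i) x) = graft (s \<sigma>) (graft (s zs @ e i) (\<Phi> (graft (a zs @ w j) x)))"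
        using lift[OF that(1,3)] we[OF that(3)] by simp
      also have "\<dots> = graft (s \<sigma> @ e i) (\<Phi> (graft (a zs @ w j) x))"
        using len(2)[OF that(1) zs] by (rule graft_graft_append)
      also have "\<dots> = graft (s \<sigma> @ e i) (graft (s \<tau>) (\<Phi> (graft (a zs @ w j) x)))"
        using len(2)[OF that(2,1)] by (simp add: graft_graft)
      also have "\<dots> = graft (s \<sigma> @ e i) (\<Phi> (graft (a \<tau> @ w j) x))"
        using lift[OF that(2,3)] by simp
      finally show ?thesis .
    qed
    have "coherent (Suc m) st'"
      unfolding coherent_def st'_def prod.case
    proof (intro allI impI conjI ballI)
      fix \<sigma> \<tau> :: "bool list" assume "length \<sigma> = Suc m" "length \<tau> = Suc m"
      then have *: "length (butlast \<sigma>) = m" "length (butlast \<tau>) = m"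
        by simp_all
      show "length (a (butlast \<sigma>) @ w (last \<sigma>)) = length (a (butlast \<tau>) @ w (last \<tau>))"
        using len(1)[OF *] len_we(1)[of "last \<sigma>" "last \<tau>"] by simp
      show "length (s (butlast \<sigma>) @ e (last \<sigma>)) = length (s (butlast \<tau>) @ e (last \<tau>))"
        using len(2)[OF *] len_we(2)[of "last \<sigma>" "last \<tau>"] by simp
      show "\<Phi> (graft (a (butlast \<sigma>) @ w (last \<sigma>)) x) =
          graft (s (butlast \<sigma>) @ e (last \<sigma>)) (\<Phi> (graft (a (butlast \<tau>) @ w (last \<tau>)) x))"
        if "x \<in> G" for x
        using * that by (rule step)
    qed
    moreover have "extends m st st' w e"
      using good Dm by (simp add: extends_def st'_def as)
    ultimately show "\<exists>st'. (coherent (Suc m) st' \<and> (Suc m = 0 \<longrightarrow> st' = (\<lambda>_. u0, \<lambda>_. s0))) \<and>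
        (\<exists>w e. extends m st st' w e)"
      by (intro exI[of _ st'] conjI) auto
  qed
  then obtain f where coh: "\<And>m. coherent m (f m)" and f0: "f 0 = (\<lambda>_. u0, \<lambda>_. s0)"
    and ext: "\<And>m. \<exists>w e. extends m (f m) (f (Suc m)) w e"
    by blast
  then obtain w e where we: "\<And>m. extends m (f m) (f (Suc m)) (w m) (e m)"
    by metis
  have good: "good (w m) (e m)" for m
    using we[of m] by (simp add: extends_def)
  have f_node: "fst (f (length \<sigma>)) \<sigma> = E0_tree_node u0 w \<sigma> \<and> snd (f (length \<sigma>)) \<sigma> = E0_tree_node s0 e \<sigma>"
    for \<sigma>
  proof (induction \<sigma> rule: rev_induct)
    case (snoc j \<sigma>)
    then show ?case
      using we[of "length \<sigma>"] by (simp add: extends_def E0_tree_node_snoc)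
  qed (simp add: f0)
  have "\<exists>y\<in>G \<inter> cyl u0. \<forall>m. \<Phi> y \<in> cyl (E0_tree_node s0 e (map \<alpha> [0..<m]))" for \<alpha>
  proof -
    \<comment> \<open>The argument nodes along \<open>\<alpha>\<close> shrink to a point
      \<open>y\<close>; the inclusions in \<open>D m\<close> put it into \<open>G\<close>.\<close>
    define g where "g m = E0_tree_node u0 w (map \<alpha> [0..<m])" for m
    have g_Suc: "g (Suc m) = g m @ w m (\<alpha> m)" for m
      by (simp add: g_def E0_tree_node_snoc)
    have "strict_prefix (g m) (g (Suc m))" for m
      using good[of m] unfolding g_Suc good_def by (simp add: strict_prefix_def)
    then obtain y where y: "\<And>m. y \<in> cyl (g m)"
      using strict_prefix_chain_limit[of g] by blast
    have "cyl (g (Suc m)) \<subseteq> D m" for m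
    proof -
      have "length (map \<alpha> [0..<m]) = m"
        by simp
      then have "cyl (fst (f (Suc m)) (map \<alpha> [0..<m] @ [\<alpha> m])) \<subseteq> D m"
        using we[of m] unfolding extends_def by blast
      moreover have "fst (f (Suc m)) (map \<alpha> [0..<m] @ [\<alpha> m]) = g (Suc m)"
        using f_node[of "map \<alpha> [0..<m] @ [\<alpha> m]"] by (simp add: g_def)
      ultimately show ?thesis
        by (simp only:)
    qed
    then have "y \<in> G"
      using y D(2) by blast
    moreover have "y \<in> cyl u0"
      using y[of 0] by (simp add: g_def)
    moreover have "\<Phi> y \<in> cyl (E0_tree_node s0 e (map \<alpha> [0..<m]))" for m
    proof -
      let ?\<sigma> = "map \<alpha> [0..<m]"
      have "coherent m (fst (f m), snd (f m))"
        using coh by simp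
      then have "\<Phi> (graft (fst (f m) ?\<sigma>) y) = graft (snd (f m) ?\<sigma>) (\<Phi> (graft (fst (f m) ?\<sigma>) y))"
        using \<open>y \<in> G\<close> unfolding coherent_def prod.case by simp
      moreover have "fst (f m) ?\<sigma> = g m" "snd (f m) ?\<sigma> = E0_tree_node s0 e ?\<sigma>"
        using f_node[of ?\<sigma>] by (simp_all add: g_def)
      ultimately have eq: "\<Phi> y = graft (E0_tree_node s0 e ?\<sigma>) (\<Phi> y)"
        by (simp only: graft_id[OF y])
      show ?thesis
        using graft_in_cyl[of "E0_tree_node s0 e ?\<sigma>" "\<Phi> y"] unfolding eq[symmetric] .
    qed
    ultimately show ?thesis by blast
  qed
  then show ?thesis
    using good that unfolding good_def by blast
qed

end

text \<open>The common initial segment of two extensions is moved into the preceding ones.\<close>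

lemma E0_tree_node_shift:
  assumes "\<And>m j. e m j = r m @ [j] @ p m j"
  shows "E0_tree_node (t @ r 0) (\<lambda>m j. [j] @ p m j @ r (Suc m)) \<sigma> = E0_tree_node t e \<sigma> @ r (length \<sigma>)"
proof (induction \<sigma> rule: rev_induct)
  case (snoc j \<sigma>)
  then show ?case
    by (simp add: E0_tree_node_snoc assms)
qed simp

section \<open>From the given reduction to the trees\<close>

lemma generic_reduction_exists:
  fixes B :: "'i::countable \<Rightarrow> (nat \<Rightarrow> bool) set"
  assumes \<Phi>: "Delta11_function \<Phi>" and red: "\<And>x y. (x, y) \<in> E0 \<longleftrightarrow> (\<Phi> x, \<Phi> y) \<in> E0"
    and B: "\<And>i. Sigma11 (B i)"
  obtains G where "generic_reduction \<Phi> G"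
    and "\<And>x i. x \<in> G \<Longrightarrow> \<exists>n. \<forall>y\<in>G \<inter> cyl (map x [0..<n]). \<Phi> y \<in> B i \<longleftrightarrow> \<Phi> x \<in> B i"
proof -
  \<comment> \<open>Deciding the digit sets gives continuity, and deciding the \<open>B i\<close>
    gives the second conclusion; the sum type yields one comeager set for both.\<close>
  define S where "S c = (case c of Inl i \<Rightarrow> \<Phi> -` {y. y i} | Inr i \<Rightarrow> \<Phi> -` B i)" for c :: "nat + 'i"
  have "closed ((\<lambda>y :: nat \<Rightarrow> bool. y i) -` {True})" for i
    by (rule closed_vimage) simp_all
  then have "Sigma11 {y :: nat \<Rightarrow> bool. y i}" for i
    by (intro closed_Sigma11) (simp add: vimage_def)
  then have "baire_property (S c)" for c
    unfolding S_def using baire_property_Delta11_vimage[OF \<Phi>] B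
    by (cases c) (simp_all del: vimage_Collect_eq)
  then obtain G0 where G0: "comeager G0"
    "\<And>x c. x \<in> G0 \<Longrightarrow> \<exists>n. \<forall>y\<in>G0 \<inter> cyl (map x [0..<n]). y \<in> S c \<longleftrightarrow> x \<in> S c"
    using comeager_deciding[of S] by blast
  \<comment> \<open>This is the largest \<open>E0\<close>-invariant subset of
    \<open>G0\<close>.\<close>
  define G where "G = {x. \<forall>u. graft u x \<in> G0}"
  have G: "G \<subseteq> G0"
  proof
    fix x assume "x \<in> G"
    then have "graft [] x \<in> G0"
      unfolding G_def by blast
    then show "x \<in> G0"
      by (simp add: graft_def)
  qed
  have "generic_reduction \<Phi> G"
  proof
    show "comeager G"
      unfolding G_def using G0(1) by (rule comeager_graft)
    show "graft u x \<in> G" if "x \<in> G" for x u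
      using that unfolding G_def by (simp add: graft_graft_drop)
    show "\<exists>n. \<forall>y\<in>G \<inter> cyl (map x [0..<n]). \<Phi> y i = \<Phi> x i" if x: "x \<in> G" for x i
    proof -
      obtain n where "\<forall>y\<in>G0 \<inter> cyl (map x [0..<n]). y \<in> S (Inl i) \<longleftrightarrow> x \<in> S (Inl i)"
        using G0(2) x G by blast
      then show ?thesis
        using G by (intro exI[of _ n]) (auto simp: S_def)
    qed
  qed (rule red)
  moreover have "\<exists>n. \<forall>y\<in>G \<inter> cyl (map x [0..<n]). \<Phi> y \<in> B i \<longleftrightarrow> \<Phi> x \<in> B i" if x: "x \<in> G" for x i
  proof -
    obtain n where "\<forall>y\<in>G0 \<inter> cyl (map x [0..<n]). y \<in> S (Inr i) \<longleftrightarrow> x \<in> S (Inr i)"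
      using G0(2) x G by blast
    then show ?thesis
      using G by (intro exI[of _ n]) (auto simp: S_def)
  qed
  ultimately show ?thesis
    using that by blast
qed

lemma E0_graft_representatives:
  fixes n :: nat
  assumes "\<And>k. k < n \<Longrightarrow> z \<in> E0 `` A k"
  shows "\<exists>L \<tau>. (\<forall>k. length (\<tau> k) = L) \<and> (\<forall>k<n. graft (\<tau> k) z \<in> A k)"
proof -
  have "\<exists>y N. k < n \<longrightarrow> y \<in> A k \<and> (\<forall>i>N. y i = z i)" for k
    using assms[of k] unfolding E0_def by blast
  then obtain y N where yN: "\<And>k. k < n \<Longrightarrow> y k \<in> A k \<and> (\<forall>i>N k. y k i = z i)"
    by metis
  \<comment> \<open>One length serves all \<open>k\<close>; \<open>Suc\<close> is there because
    agreement holds only strictly beyond \<open>N k\<close>.\<close>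
  define L where "L = Suc (\<Sum>k<n. N k)"
  have "graft (map (y k) [0..<L]) z = y k" if "k < n" for k
  proof
    fix i
    have "N k \<le> (\<Sum>k<n. N k)"
      using that by (intro member_le_sum) auto
    then have "N k < L"
      by (simp add: L_def)
    then show "graft (map (y k) [0..<L]) z i = y k i"
      using yN[OF that] by (simp add: graft_def)
  qed
  then show ?thesis
    using yN by (intro exI[of _ L] exI[of _ "\<lambda>k. map (y k) [0..<L]"]) simp
qed

theorem theorem5p7:
  fixes n :: nat and A :: "nat \<Rightarrow> (nat \<Rightarrow> bool) set"
  assumes "\<And>k. k < n \<Longrightarrow> Sigma11 (A k)"
    and "\<And>k. k < n \<Longrightarrow> E0 \<le>\<^sub>\<Delta> Restr E0 (A k)"
    and "\<And>k. Suc k < n \<Longrightarrow> E0 `` A k \<subseteq> E0 `` A (Suc k)"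
  shows "\<exists>(p :: nat \<Rightarrow> bool list set) (s :: nat \<Rightarrow> bool list) (v :: nat \<Rightarrow> nat \<Rightarrow> bool \<Rightarrow> bool list).
    (\<forall>k<n. is_E0_tree (p k) (s k) (v k) \<and> branches (p k) \<subseteq> A k) \<and>
    (\<forall>a<n. \<forall>b<n. length (s a) = length (s b) \<and> (\<forall>m i. v a m i = v b m i))"
proof (cases "n = 0")
  case False
  then obtain \<Phi> where \<Phi>: "Delta11_function \<Phi>" "range \<Phi> \<subseteq> A 0"
    and red: "\<And>x y. (x, y) \<in> E0 \<longleftrightarrow> (\<Phi> x, \<Phi> y) \<in> E0"
    using assms(2)[of 0] unfolding E0_reducible_to_restriction_iff by auto
  \<comment> \<open>The strings \<open>\<tau> k\<close> will depend on a point of \<open>G\<close>,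
    so \<open>B\<close> covers all strings in advance. Indices \<open>k \<ge> n\<close> get the
    default \<open>A 0\<close>, which is analytic because \<open>n \<noteq> 0\<close>.\<close>
  define B where "B = (\<lambda>(t, k). graft t -` A (if k < n then k else 0))"
  have "Sigma11 (B c)" for c
    using False by (auto simp: B_def split: prod.split intro!: Sigma11_vimage assms(1) continuous_on_graft)
  then obtain G where G: "generic_reduction \<Phi> G"
    and decide: "\<And>x c. x \<in> G \<Longrightarrow> \<exists>n. \<forall>y\<in>G \<inter> cyl (map x [0..<n]). \<Phi> y \<in> B c \<longleftrightarrow> \<Phi> x \<in> B c"
    using generic_reduction_exists[OF \<Phi>(1) red, of B] by blast
  interpret generic_reduction \<Phi> G
    by (rule G)
  obtain x where x: "x \<in> G"
    using comeager_meets_cyl[OF comeager] by blast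
  have sat: "E0 `` A 0 \<subseteq> E0 `` A k" if "k < n" for k
    using that
  proof (induction k)
    case (Suc k)
    then show ?case
      using assms(3)[of k] by auto
  qed simp
  have "\<Phi> x \<in> E0 `` A 0"
    using \<Phi>(2) by (force simp: E0_def)
  then have "\<Phi> x \<in> E0 `` A k" if "k < n" for k
    using sat[OF that] by (rule rev_subsetD)
  then obtain L \<tau> where len_\<tau>: "\<And>k. length (\<tau> k) = L" and \<tau>: "\<And>k. k < n \<Longrightarrow> graft (\<tau> k) (\<Phi> x) \<in> A k"
    using E0_graft_representatives[of n "\<Phi> x" A] by metis
  have "\<exists>n. \<forall>y\<in>G \<inter> cyl (map x [0..<n]). \<Phi> y \<in> B (\<tau> k, k) \<longleftrightarrow> \<Phi> x \<in> B (\<tau> k, k)" for k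
    using x by (rule decide)
  then obtain N where N: "\<And>k. \<forall>y\<in>G \<inter> cyl (map x [0..<N k]). \<Phi> y \<in> B (\<tau> k, k) \<longleftrightarrow> \<Phi> x \<in> B (\<tau> k, k)"
    by metis
  \<comment> \<open>\<open>M\<close> is large enough to decide membership for all
    \<open>k < n\<close> and to fix the first \<open>L\<close> digits of the values, exactly those
    that \<open>\<tau> k\<close> overwrites.\<close>
  obtain M where M: "(\<Sum>k<n. N k) \<le> M" "\<forall>y\<in>G \<inter> cyl (map x [0..<M]). \<forall>i<L. \<Phi> y i = \<Phi> x i"
    using continuous_initial[OF x] by blast
  define u0 where "u0 = map x [0..<M]"
  define s0 where "s0 = map (\<Phi> x) [0..<L]"
  have u0: "graft (\<tau> k) (\<Phi> y) \<in> A k" if "k < n" "y \<in> G \<inter> cyl u0" for k y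
  proof -
    have "N k \<le> (\<Sum>k<n. N k)"
      using that(1) by (intro member_le_sum) auto
    then have "y \<in> G \<inter> cyl (map x [0..<N k])"
      using that(2) M(1) cyl_initial_mono[of "N k" M x] by (auto simp: u0_def)
    then show ?thesis
      using N[of k] \<tau>[OF that(1)] that(1) by (simp add: B_def)
  qed
  have "\<Phi> (graft u0 y) \<in> cyl s0" if "y \<in> G" for y
    using M(2) graft_G[OF that] graft_in_cyl[of u0 y] by (simp add: u0_def s0_def cyl_def)
  then obtain e where len_e: "\<And>m. length (e m False) = length (e m True)"
    and split_e: "\<And>m. \<exists>r p. \<forall>j. e m j = r @ [j] @ p j"
    and scheme: "\<And>\<alpha>. \<exists>y\<in>G \<inter> cyl u0. \<forall>m. \<Phi> y \<in> cyl (E0_tree_node s0 e (map \<alpha> [0..<m]))"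
    using splitting_scheme[of u0 s0] by blast
  obtain r p where e: "\<And>m j. e m j = r m @ [j] @ p m j"
    using split_e by metis
  define v where "v = (\<lambda>m j. [j] @ p m j @ r (Suc m))"
  define T where "T k = {t. \<exists>\<sigma>. prefix t (E0_tree_node (\<tau> k @ r 0) v \<sigma>)}" for k
  have tree: "is_E0_tree (T k) (\<tau> k @ r 0) v" for k
    unfolding is_E0_tree_def T_def using len_e by (simp add: v_def e)
  have "branches (T k) \<subseteq> A k" if k: "k < n" for k
  proof
    fix z assume "z \<in> branches (T k)"
    then obtain \<alpha> where \<alpha>: "\<And>m. z \<in> cyl (E0_tree_node (\<tau> k @ r 0) v (map \<alpha> [0..<m]))"
      using branches_E0_tree[OF tree] by blast
    have "z \<in> cyl ((\<tau> k @ E0_tree_node [] e (map \<alpha> [0..<m])) @ r m)" for m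
      using \<alpha>[of m] E0_tree_node_shift[of e r p "\<tau> k" "map \<alpha> [0..<m]", OF e]
      unfolding v_def[symmetric] E0_tree_node_stem[of "\<tau> k" e] by simp
    then have z: "z \<in> cyl (\<tau> k @ E0_tree_node [] e (map \<alpha> [0..<m]))" for m
      using cyl_append by blast
    obtain y where y: "y \<in> G \<inter> cyl u0" "\<And>m. \<Phi> y \<in> cyl (s0 @ E0_tree_node [] e (map \<alpha> [0..<m]))"
      using scheme[of \<alpha>] unfolding E0_tree_node_stem[of s0 e] by blast
    \<comment> \<open>\<open>\<Phi> y\<close> follows \<open>\<alpha>\<close> above the stem
      \<open>s0\<close>; since \<open>s0\<close> and \<open>\<tau> k\<close> have equal length,
      exchanging the stems turns it into \<open>z\<close>.\<close>
    have "graft (\<tau> k) (\<Phi> y) = z"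
    proof
      fix i
      \<comment> \<open>Every level contributes at least one digit, so \<open>Suc i\<close> levels
        determine digit \<open>i\<close>.\<close>
      let ?w = "E0_tree_node [] e (map \<alpha> [0..<Suc i])"
      have "i < length ?w"
        using length_E0_tree_node_ge[of e "map \<alpha> [0..<Suc i]" "[]"] by (simp add: e)
      moreover have "graft (\<tau> k) (\<Phi> y) \<in> cyl (\<tau> k @ ?w)"
        using y(2) by (rule graft_append_cyl) (simp add: s0_def len_\<tau>)
      ultimately show "graft (\<tau> k) (\<Phi> y) i = z i"
        using z[of "Suc i"] by (simp add: cyl_def)
    qed
    then show "z \<in> A k"
      using u0[OF k y(1)] by simp
  qed
  then show ?thesis
    using tree len_\<tau> by (intro exI[of _ T] exI[of _ "\<lambda>k. \<tau> k @ r 0"] exI[of _ "\<lambda>_. v"]) simp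
qed simp

end
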